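(* For every real $x$ with $0\le x<\infty$, the synchrotron function $F(x)=x\int_x^\infty K_{5/3}(z)\,dz$ satisfies $$F(x) = -\frac{\pi}{\sqrt{3}}\,x + (4x)^{1/3}\,\Gamma\!\left(\tfrac{2}{3}\right)\,{}_1F_2\!\left(-\tfrac13;\,-\tfrac23,\tfrac23;\,\tfrac{x^2}{4}\right) + \left(\frac{x^{11}}{256}\right)^{1/3}\Gamma\!\left(-\tfrac{8}{3}\right)\,{}_1F_2\!\left(\tfrac43;\,\tfrac83,\tfrac73;\,\tfrac{x^2}{4}\right),$$ where at $x=0$ the value $F(0)$ is understood as $\lim_{x\to0^+}F(x)$.
   Context: $K_\nu$ denotes the modified Bessel function of the second kind, $K_\nu(x)=\frac{\pi}{2}\frac{I_{-\nu}(x)-I_\nu(x)}{\sin(\nu\pi)}$ for non-integer $\nu$ and $x>0$, where $I_\nu$ is the modified Bessel function of the first kind. The synchrotron function is $F(x)=x\int_x^\infty K_{5/3}(z)\,dz$ for $x>0$. The generalized hypergeometric function is ${}_1F_2(a;b_1,b_2;z)=\sum_{n=0}^\infty\frac{(a)_n}{(b_1)_n(b_2)_n}\frac{z^n}{n!}$ with Pochhammer symbol $(\beta)_n=\Gamma(\beta+n)/\Gamma(\beta)=\beta(\beta+1)\cdots(\beta+n-1)$; no $b_i$ is a non-positive integer here, so the series converges for all $z$. $\Gamma$ is the Gamma function, and cube roots are real. *)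

theory Defs
  imports "HOL-Analysis.Analysis"
begin

text \<open>
  Real order and positive real argument are intended throughout (\<open>powr\<close> is not meaningful for
  negative bases).  The reciprocal Gamma function \<open>rGamma\<close> is entire and vanishes at the poles
  of \<open>Gamma\<close>, so the series is the usual one for every order, including negative integers.
\<close>

definition bessel_I :: "real \<Rightarrow> real \<Rightarrow> real" where
  "bessel_I \<nu> x = (\<Sum>m. (x / 2) powr (2 * real m + \<nu>) * rGamma (real m + \<nu> + 1) / fact m)"

text \<open>At integer order the quotient is \<open>0 / 0\<close>; the standard convention is the limit in the order.\<close>

definition bessel_K :: "real \<Rightarrow> real \<Rightarrow> real" where
  "bessel_K \<nu> x =
     (let q = (\<lambda>\<mu>. pi / 2 * ((bessel_I (- \<mu>) x - bessel_I \<mu> x) / sin (\<mu> * pi)))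
      in if \<nu> \<in> \<int> then Lim (at \<nu>) q else q \<nu>)"

text \<open>
  Only \<open>x \<ge> 0\<close> is intended.  The formula \<open>x * integral \<dots>\<close> is not used at \<open>x = 0\<close>, where the
  integral diverges; the value there is the limit from the right.
\<close>

definition synchrotron :: "real \<Rightarrow> real" where
  "synchrotron x =
     (let F = (\<lambda>t. t * integral {t..} (bessel_K (5 / 3)))
      in if x = 0 then Lim (at_right 0) F else F x)"

definition hypergeom_1F2 :: "real \<Rightarrow> real \<Rightarrow> real \<Rightarrow> real \<Rightarrow> real" where
  "hypergeom_1F2 a b1 b2 z =
     (\<Sum>n. pochhammer a n / (pochhammer b1 n * pochhammer b2 n) * (z ^ n / fact n))"

end

theory Submission
  imports Defs
begin

text \<open>
  The relation \<open>2 K\<^sub>2\<^sub>/\<^sub>3' = - K\<^sub>1\<^sub>/\<^sub>3 - K\<^sub>5\<^sub>/\<^sub>3\<close> exhibits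
  \<open>2 K\<^sub>2\<^sub>/\<^sub>3(x) + \<integral>\<^sub>0\<^sup>x K\<^sub>1\<^sub>/\<^sub>3\<close> as an antiderivative of \<open>-K\<^sub>5\<^sub>/\<^sub>3\<close>. Integrated
  term by term, its series gives the two hypergeometric functions of the claim; the remaining linear
  term is its limit at infinity, which is \<open>\<integral>\<^sub>0\<^sup>\<infinity> K\<^sub>1\<^sub>/\<^sub>3 = pi / sqrt 3\<close>.
  Decay, sign and total mass are invisible in the series defining \<open>K\<close>, so for \<open>0 < \<nu> < 1\<close> one
  identifies \<open>K\<^sub>\<nu>\<close> with the integral of \<open>s powr (\<nu> - 1) * exp (- s - y / s)\<close>, where
  \<open>y = x\<^sup>2 / 4\<close>. The inversion \<open>s \<mapsto> y / s\<close> makes the integrals of orders \<open>\<nu>\<close>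
  and \<open>1 - \<nu>\<close> solve a linear system of first order, which the series solve as well. For
  \<open>0 < \<nu> < 1\<close> both components have finite limits at 0, which are values of Gamma, so the
  solutions agree.
\<close>

section \<open>Regularised hypergeometric series\<close>

text \<open>
  The factor \<open>rGamma (n + c)\<close>, in place of the inverse of \<open>pochhammer c n\<close>, keeps the
  coefficients meaningful and the contiguous relations valid for every \<open>c\<close>. In \<open>reg_1F2 a c\<close>
  the second lower parameter is \<open>a + 1\<close>, since integrating \<open>y powr (a - 1) * y ^ n\<close>
  contributes \<open>1 / (n + a)\<close>.
\<close>

definition reg_0F1 :: "real \<Rightarrow> real \<Rightarrow> real" where
  "reg_0F1 c y = (\<Sum>n. rGamma (real n + c) / fact n * y ^ n)"

definition reg_1F2 :: "real \<Rightarrow> real \<Rightarrow> real \<Rightarrow> real" where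
  "reg_1F2 a c y = (\<Sum>n. rGamma (real n + c) / (fact n * (real n + a)) * y ^ n)"

lemma summable_reg_0F1: "summable (\<lambda>n. rGamma (real n + c) / fact n * y ^ n)"
proof -
  \<comment> \<open>The bound \<open>1 - c\<close> makes \<open>n + c\<close> at least 1, so that
    the values of \<open>rGamma\<close> stop growing in absolute value; the bound
    \<open>2 * \<bar>y\<bar>\<close> makes the factor \<open>\<bar>y\<bar> / (n + 1)\<close> at most
    1/2.\<close>
  obtain N :: nat where N: "real N \<ge> max (1 - c) (2 * \<bar>y\<bar>)"
    using real_arch_simple by blast
  show ?thesis
  proof (rule summable_ratio_test[where c = "1/2" and N = N])
    fix n assume "n \<ge> N"
    with N have n: "real n + c \<ge> 1" "2 * \<bar>y\<bar> \<le> real (Suc n)" by linarith+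
    define r where "r = \<bar>rGamma (real (Suc n) + c)\<bar>"
    have "\<bar>rGamma (real n + c)\<bar> = (real n + c) * r"
    proof -
      have "rGamma (real n + c) = (real n + c) * rGamma (real (Suc n) + c)"
        using rGamma_plus1[of "real n + c"] by (simp add: add_ac)
      thus ?thesis using n(1) by (simp add: r_def abs_mult)
    qed
    hence r: "r \<le> \<bar>rGamma (real n + c)\<bar>"
      using n(1) mult_right_mono[of 1 "real n + c" r] by (simp add: r_def)
    have "norm (rGamma (real (Suc n) + c) / fact (Suc n) * y ^ Suc n) =
          (\<bar>y\<bar> / real (Suc n)) * r * (\<bar>y\<bar> ^ n / fact n)"
      by (simp add: r_def abs_mult power_abs)
    also have "\<dots> \<le> 1/2 * \<bar>rGamma (real n + c)\<bar> * (\<bar>y\<bar> ^ n / fact n)"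
      using n r by (intro mult_right_mono mult_mono) (auto simp: field_simps r_def)
    finally show "norm (rGamma (real (Suc n) + c) / fact (Suc n) * y ^ Suc n)
        \<le> 1/2 * norm (rGamma (real n + c) / fact n * y ^ n)"
      by (simp add: abs_mult power_abs)
  qed simp
qed

text \<open>From the first \<open>n\<close> with \<open>n + a\<close> at least 1 on, division by
  \<open>n + a\<close> only shrinks the terms of the \<open>reg_0F1\<close> series. That series
  converges absolutely at \<open>y\<close> because it converges at the larger point
  \<open>\<bar>y\<bar> + 1\<close>.\<close>

lemma summable_reg_1F2: "summable (\<lambda>n. rGamma (real n + c) / (fact n * (real n + a)) * y ^ n)"
proof -
  define d where "d = (\<lambda>n. rGamma (real n + c) / fact n * y ^ n)"
  obtain N :: nat where N: "1 - a \<le> real N"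
    using real_arch_simple[of "1 - a"] by (elim exE)
  have sum: "summable (\<lambda>n. norm (d n))"
    unfolding d_def
    by (rule powser_insidea[OF summable_reg_0F1, where x = "\<bar>y\<bar> + 1"]) simp
  have "norm (d n / (real n + a)) \<le> norm (d n)" if "n \<ge> N" for n
  proof -
    have "real n + a \<ge> 1" using N that by linarith
    hence "norm (d n) / (real n + a) \<le> norm (d n) / 1"
      by (intro divide_left_mono) auto
    with \<open>real n + a \<ge> 1\<close> show ?thesis by simp
  qed
  hence "summable (\<lambda>n. d n / (real n + a))"
    using summable_comparison_test[of "\<lambda>n. d n / (real n + a)", OF _ sum] by blast
  thus ?thesis by (simp add: d_def)
qed

lemma diffs_reg_0F1:
  "diffs (\<lambda>n. rGamma (real n + c) / fact n) = (\<lambda>n. rGamma (real n + (c + 1)) / fact n)"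
  by (auto simp: diffs_def fun_eq_iff add_ac simp del: of_nat_Suc) (simp add: add_ac)

lemma diffs_reg_1F2:
  "diffs (\<lambda>n. rGamma (real n + c) / (fact n * (real n + a)))
     = (\<lambda>n. rGamma (real n + (c + 1)) / (fact n * (real n + (a + 1))))"
  by (auto simp: diffs_def fun_eq_iff add_ac simp del: of_nat_Suc) (simp add: add_ac)

lemma has_real_derivative_reg_0F1:
  "(reg_0F1 c has_real_derivative reg_0F1 (c + 1) y) (at y)"
  using termdiffs_strong_converges_everywhere[OF summable_reg_0F1, of c y]
  by (simp add: diffs_reg_0F1 reg_0F1_def[abs_def])

lemma has_real_derivative_reg_1F2:
  "(reg_1F2 a c has_real_derivative reg_1F2 (a + 1) (c + 1) y) (at y)"
  using termdiffs_strong_converges_everywhere[OF summable_reg_1F2, of c a y]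
  by (simp add: diffs_reg_1F2 reg_1F2_def[abs_def])

text \<open>The Euler operator \<open>y * d/dy + a\<close> multiplies the coefficient of index
  \<open>n\<close> by \<open>n + a\<close>. Such a factor either lowers the parameter of
  \<open>rGamma\<close> by one or cancels the denominator of \<open>reg_1F2\<close>; all contiguous
  relations below arise in this way.\<close>

lemma powser_euler:
  fixes d :: "nat \<Rightarrow> real"
  assumes "\<And>y. summable (\<lambda>n. d n * y ^ n)"
  shows "(\<Sum>n. (real n + a) * d n * y ^ n) = y * (\<Sum>n. diffs d n * y ^ n) + a * (\<Sum>n. d n * y ^ n)"
proof -
  have "summable (\<lambda>n. diffs d n * y ^ n)"
    using termdiff_converges_all[OF assms] .
  hence "(\<lambda>n. y * (diffs d n * y ^ n)) sums (y * (\<Sum>n. diffs d n * y ^ n))"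
    by (intro sums_mult summable_sums)
  hence "(\<lambda>n. real (Suc n) * d (Suc n) * y ^ Suc n) sums (y * (\<Sum>n. diffs d n * y ^ n))"
    by (simp add: diffs_def mult_ac)
  \<comment> \<open>The term of index 0 vanishes, so shifting the index leaves the sum
    unchanged.\<close>
  hence "(\<lambda>n. real n * d n * y ^ n) sums (y * (\<Sum>n. diffs d n * y ^ n))"
    by (subst (asm) sums_Suc_iff) simp
  moreover have "(\<lambda>n. a * (d n * y ^ n)) sums (a * (\<Sum>n. d n * y ^ n))"
    by (intro sums_mult summable_sums assms)
  ultimately have "(\<lambda>n. real n * d n * y ^ n + a * (d n * y ^ n)) sums
      (y * (\<Sum>n. diffs d n * y ^ n) + a * (\<Sum>n. d n * y ^ n))"
    by (rule sums_add)
  thus ?thesis by (simp add: sums_iff algebra_simps)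
qed

lemma rGamma_minus1: "rGamma (real n + (c - 1)) = (real n + (c - 1)) * rGamma (real n + c)"
  using rGamma_plus1[of "real n + (c - 1)"] by simp

lemma reg_0F1_contiguous: "reg_0F1 (c - 1) y = y * reg_0F1 (c + 1) y + (c - 1) * reg_0F1 c y"
  using powser_euler[OF summable_reg_0F1, of "c - 1" c y] rGamma_minus1[of _ c, symmetric]
  by (simp add: diffs_reg_0F1 reg_0F1_def)

lemma reg_1F2_euler:
  assumes "\<And>n. real n + a \<noteq> 0"
  shows "reg_0F1 c y = y * reg_1F2 (a + 1) (c + 1) y + a * reg_1F2 a c y"
  using powser_euler[OF summable_reg_1F2, of a c a y] assms
  by (simp add: diffs_reg_1F2 reg_1F2_def reg_0F1_def)

text \<open>The integrated form of \<open>2 K\<^sub>\<nu>' = - K\<^bsub>\<nu> - 1\<^esub> - K\<^bsub>\<nu> + 1\<^esub>\<close>.\<close>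

lemma reg_1F2_contiguous:
  assumes "\<And>n. real n + a \<noteq> 0"
  shows "reg_1F2 a (2 * a) y + y * reg_1F2 (a + 1) (2 * a + 2) y = 2 * reg_0F1 (2 * a + 1) y"
proof -
  \<comment> \<open>Two Euler relations for the parameter \<open>2 * a + 1\<close>: here with the
    constant \<open>2 * a\<close>, below with the constant \<open>a\<close>. Eliminating
    \<open>reg_1F2 a (2 * a + 1) y\<close> between them leaves the claim.\<close>
  have "reg_1F2 a (2 * a) y = y * reg_1F2 (a + 1) (2 * a + 2) y + 2 * a * reg_1F2 a (2 * a + 1) y"
    using powser_euler[OF summable_reg_1F2, of "2 * a" "2 * a + 1" a y]
      rGamma_minus1[of _ "2 * a + 1"] 
    by (simp add: diffs_reg_1F2 reg_1F2_def add.assoc)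
  with reg_1F2_euler[OF assms, of "2 * a + 1" y] show ?thesis
    by (simp add: add.assoc algebra_simps)
qed

text \<open>With \<open>y = x^2 / 4\<close> this is the rule that \<open>x^c * I_c\<close> has the
  derivative \<open>x^c * I_(c - 1)\<close>.\<close>

lemma has_real_derivative_powr_reg_0F1:
  assumes "y > 0"
  shows "((\<lambda>y. y powr c * reg_0F1 (c + 1) y) has_real_derivative y powr (c - 1) * reg_0F1 c y) (at y)"
proof -
  have "y powr c = y * y powr (c - 1)"
    using assms by (simp add: powr_diff)
  thus ?thesis using assms reg_0F1_contiguous[of "c + 1" y]
    by (auto intro!: derivative_eq_intros has_real_derivative_reg_0F1 simp: algebra_simps)
qed

lemma has_real_derivative_powr_reg_1F2:
  assumes "y > 0" "\<And>n. real n + a \<noteq> 0"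
  shows "((\<lambda>y. y powr a * reg_1F2 a c y) has_real_derivative y powr (a - 1) * reg_0F1 c y) (at y)"
proof -
  have "y powr a = y * y powr (a - 1)"
    using assms by (simp add: powr_diff)
  thus ?thesis using assms reg_1F2_euler[of a c y]
    by (auto intro!: derivative_eq_intros has_real_derivative_reg_1F2 simp: algebra_simps)
qed

text \<open>All coefficients are positive. This permits division by
  \<open>reg_0F1 (1 - \<nu>)\<close> in the uniqueness argument for
  \<open>bessel_integral\<close>.\<close>

lemma reg_0F1_pos:
  assumes "c > 0" "y \<ge> 0"
  shows "reg_0F1 c y > 0"
proof -
  have "rGamma c > 0" and nn: "\<And>n. rGamma (real n + c) > 0"
    using assms by (auto simp: rGamma_inverse_Gamma intro!: Gamma_real_pos)
  show ?thesis unfolding reg_0F1_def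
    using assms \<open>rGamma c > 0\<close> nn less_imp_le
    by (intro suminf_pos2[OF summable_reg_0F1, where i = 0]) (auto simp: less_imp_le)
qed

section \<open>Bessel and hypergeometric functions in terms of the regularised series\<close>

lemma bessel_I_eq_reg_0F1:
  assumes "x > 0"
  shows "bessel_I \<nu> x = (x / 2) powr \<nu> * reg_0F1 (\<nu> + 1) (x\<^sup>2 / 4)"
proof -
  have "(x / 2) powr (2 * real m + \<nu>) = (x / 2) powr \<nu> * (x\<^sup>2 / 4) ^ m" for m
  proof -
    have "(x / 2) powr (2 * real m) = (x / 2) ^ (2 * m)"
      using assms powr_realpow[of "x / 2" "2 * m"] by simp
    thus ?thesis by (simp add: powr_add power_mult power_divide)
  qed
  thus ?thesis unfolding bessel_I_def reg_0F1_def
    by (subst suminf_mult[OF summable_reg_0F1, symmetric]) (simp add: mult_ac add_ac)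
qed

text \<open>The quotient of the Pochhammer symbols of \<open>a\<close> and \<open>a + 1\<close>
  telescopes to \<open>a / (n + a)\<close>, and the inverse of \<open>pochhammer c n\<close> is
  \<open>Gamma c * rGamma (n + c)\<close>.\<close>

lemma hypergeom_1F2_eq_reg_1F2:
  assumes "\<And>n. real n + a \<noteq> 0" "c \<notin> \<int>\<^sub>\<le>\<^sub>0"
  shows "hypergeom_1F2 a c (a + 1) y = a * Gamma c * reg_1F2 a c y"
proof -
  have "pochhammer a n / (pochhammer c n * pochhammer (a + 1) n) * (y ^ n / fact n) =
     a * Gamma c * (rGamma (real n + c) / (fact n * (real n + a)) * y ^ n)" for n
  proof -
    have a: "pochhammer a n * (real n + a) = a * pochhammer (a + 1) n"
      using pochhammer_rec[of a n] pochhammer_Suc[of a n] by (simp add: mult_ac add_ac)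
    have nz: "pochhammer c n \<noteq> 0"
      using assms(2) pochhammer_eq_0_imp_nonpos_Int by blast
    have c: "Gamma c * rGamma (real n + c) * pochhammer c n = 1"
      using pochhammer_rGamma[of c n] assms(2)
nz
      by (simp add: rGamma_inverse_Gamma Gamma_eq_zero_iff add_ac mult_ac field_simps)
    have nz': "pochhammer (a + 1) n \<noteq> 0"
      using assms(1)[of "Suc _"] by (auto simp: pochhammer_eq_0_iff add_ac)
         (metis add.commute add.left_commute add.right_inverse)
    have "pochhammer a n / (pochhammer c n * pochhammer (a + 1) n)
        = a * (Gamma c * rGamma (real n + c)) / (real n + a)"
      using a c nz nz' assms(1)[of n] by (simp add: field_simps) 
    thus ?thesis by (simp only: times_divide_eq_left times_divide_eq_right) (simp add: mult_ac)
  qed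
  thus ?thesis unfolding hypergeom_1F2_def reg_1F2_def
    by (subst suminf_mult[OF summable_reg_1F2, symmetric]) (simp add: mult_ac)
qed

section \<open>The integral representation\<close>

text \<open>\<open>K\<^sub>\<nu>(x) = (x / 2) powr (- \<nu>) * bessel_integral \<nu> (x\<^sup>2 / 4) / 2\<close>.\<close>

definition bessel_kernel :: "real \<Rightarrow> real \<Rightarrow> real \<Rightarrow> real" where
  "bessel_kernel \<nu> y s = s powr (\<nu> - 1) * exp (- s - y / s)"

definition bessel_integral :: "real \<Rightarrow> real \<Rightarrow> real" where
  "bessel_integral \<nu> y = integral {0<..} (bessel_kernel \<nu> y)"

lemma Gamma_integral_real_open:
  assumes "x > (0 :: real)"
  shows   "((\<lambda>t. t powr (x - 1) / exp t) has_integral Gamma x) {0<..}"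
proof -
  have "((\<lambda>t. if t \<in> {0<..} then t powr (x - 1) / exp t else 0) has_integral Gamma x) {0..}"
    by (rule has_integral_spike[OF _ _ Gamma_integral_real[OF assms], of "{0}"]) auto
  thus ?thesis by (subst (asm) has_integral_restrict) auto
qed

text \<open>A single term of the exponential series. It bounds \<open>exp (- y / s)\<close> by any
  chosen power of \<open>s\<close> near 0.\<close>

lemma power_div_fact_le_exp:
  fixes x :: real
  assumes "x \<ge> 0"
  shows "x ^ n / fact n \<le> exp x"
proof -
  have "(\<Sum>k\<in>{n}. x ^ k /\<^sub>R fact k) \<le> (\<Sum>k. x ^ k /\<^sub>R fact k)"
    using assms by (intro sum_le_suminf summable_exp_generic) auto
  thus ?thesis by (simp add: exp_def divide_inverse mult.commute)
qed

lemma bessel_kernel_nonneg: "bessel_kernel \<nu> y s \<ge> 0"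
  by (simp add: bessel_kernel_def)

lemma bessel_kernel_absolutely_integrable:
  assumes "y > 0 \<or> \<nu> > 0 \<and> y = 0"
  shows "bessel_kernel \<nu> y absolutely_integrable_on {0<..}"
proof -
  \<comment> \<open>For positive \<open>y\<close> the factor \<open>exp (- y / s)\<close> supplies
    \<open>s ^ n\<close>, enough to raise the exponent \<open>\<nu>\<close> to a positive one; for
    \<open>y = 0\<close> the order is positive already and \<open>n = 0\<close> serves. The majorant
    is then a multiple of a Gamma integrand.\<close>
  obtain n :: nat where n: "\<nu> + real n > 0" "y > 0 \<or> n = 0 \<and> y = 0"
  proof (cases "y > 0")
    case True
    obtain n :: nat where "real n > - \<nu>" using reals_Archimedean2 by blast
    with that[of n] True show ?thesis by simp
  qed (use assms that[of 0] in auto)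
  define g where "g = (\<lambda>s. fact n / y ^ n * (s powr (\<nu> + real n - 1) / exp s))"
  show ?thesis
  proof (rule measurable_bounded_by_integrable_imp_absolutely_integrable)
    show "bessel_kernel \<nu> y \<in> borel_measurable (lebesgue_on {0<..})"
      unfolding bessel_kernel_def
      by (intro continuous_imp_measurable_on_sets_lebesgue continuous_intros) auto
    show "g integrable_on {0<..}"
      using Gamma_integral_real_open[OF n(1)] unfolding g_def
      by (intro integrable_on_mult_right) (auto simp: integrable_on_def)
    fix s :: real assume "s \<in> {0<..}"
    hence s: "s > 0" by simp
    have "exp (- (y / s)) \<le> fact n * s ^ n / y ^ n"
    proof (cases "y > 0")
      case True
      have "(y / s) ^ n / fact n \<le> exp (y / s)"
        using True s by (intro power_div_fact_le_exp) auto
      thus ?thesis using True s by (simp add: exp_minus field_simps power_divide)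
    qed (use n(2) in auto)
    hence "s powr (\<nu> - 1) * exp (- s) * exp (- (y / s)) \<le> s powr (\<nu> - 1) * exp (- s) * (fact n * s ^ n / y ^ n)"
      by (intro mult_left_mono) auto
    also have "\<dots> = g s"
      using s by (simp add: g_def powr_diff powr_add powr_realpow exp_minus field_simps)
    finally show "norm (bessel_kernel \<nu> y s) \<le> g s"
      by (simp add: bessel_kernel_def exp_diff exp_minus divide_inverse mult_ac)
  qed auto
qed

lemma bessel_kernel_integrable:
  "y > 0 \<or> \<nu> > 0 \<and> y = 0 \<Longrightarrow> bessel_kernel \<nu> y integrable_on {0<..}"
  by (rule set_lebesgue_integral_eq_integral(1)[OF bessel_kernel_absolutely_integrable])

lemma bessel_integral_nonneg: "bessel_integral \<nu> y \<ge> 0"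
\<comment> \<open>Where the kernel is not integrable, the integral has the default value 0.\<close>
proof (cases "bessel_kernel \<nu> y integrable_on {0<..}")
  case True
  thus ?thesis unfolding bessel_integral_def by (rule integral_nonneg) (rule bessel_kernel_nonneg)
qed (simp add: bessel_integral_def not_integrable_integral)

text \<open>A Taylor remainder for differentiation under the integral sign. Both directions come
  from \<open>1 + v \<le> exp v\<close>, taken at \<open>u\<close> and at
  \<open>- u\<close>.\<close>

lemma exp_second_order_bound:
  fixes u :: real
  shows "\<bar>exp u - 1 - u\<bar> \<le> u\<^sup>2 * exp \<bar>u\<bar>"
proof -
  have lo: "0 \<le> exp u - 1 - u" using exp_ge_add_one_self[of u] by linarith
  have "exp u * (1 - u) \<le> exp u * exp (- u)"
    using exp_ge_add_one_self[of "- u"] by (intro mult_left_mono) auto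
  hence 1: "exp u - 1 \<le> u * exp u" by (simp add: algebra_simps exp_minus)
  have "exp u - 1 - u \<le> u\<^sup>2 * exp \<bar>u\<bar>"
  proof (cases "u \<ge> 0")
    case True
    have "u * (exp u - 1) \<le> u * (u * exp u)" using 1 True by (intro mult_left_mono)
    thus ?thesis using 1 True by (simp add: power2_eq_square algebra_simps)
  next
    case False
    have "- u * (1 - exp u) \<le> - u * (- u)"
      using lo False by (intro mult_left_mono) linarith+
    hence "exp u - 1 - u \<le> u\<^sup>2 * 1" using 1 by (simp add: power2_eq_square algebra_simps)
    also have "\<dots> \<le> u\<^sup>2 * exp \<bar>u\<bar>" by (intro mult_left_mono) auto
    finally show ?thesis .
  qed
  with lo show ?thesis by simp
qed

lemma has_real_derivative_bessel_integral:
  assumes y: "y > 0"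
  shows "(bessel_integral \<nu> has_real_derivative - bessel_integral (\<nu> - 1) y) (at y)"
proof -
  \<comment> \<open>The remainder in the exponent change \<open>u = - h / s\<close> contributes
    \<open>u^2\<close>, which lowers the order by 2, and \<open>exp \<bar>u\<bar>\<close>, which
    costs at most half of \<open>y\<close> once \<open>\<bar>h\<bar> < y / 2\<close>.\<close>
  define M where "M = bessel_integral (\<nu> - 2) (y / 2)"
  have bound: "\<bar>(bessel_integral \<nu> (y + h) - bessel_integral \<nu> y) / h + bessel_integral (\<nu> - 1) y\<bar> \<le> M * \<bar>h\<bar>"
    if h: "h \<noteq> 0" "\<bar>h\<bar> < y / 2" for h
  proof -
    have yh: "y + h > 0" using h by linarith
    let ?d = "\<lambda>s. bessel_kernel \<nu> (y + h) s - bessel_kernel \<nu> y s + h * bessel_kernel (\<nu> - 1) y s"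
    have int: "bessel_kernel \<nu> (y + h) integrable_on {0<..}" "bessel_kernel \<nu> y integrable_on {0<..}"
       "bessel_kernel (\<nu> - 1) y integrable_on {0<..}" "bessel_kernel (\<nu> - 2) (y / 2) integrable_on {0<..}"
      using y yh by (auto intro!: bessel_kernel_integrable)
    have "norm (integral {0<..} ?d) \<le> integral {0<..} (\<lambda>s. h\<^sup>2 * bessel_kernel (\<nu> - 2) (y / 2) s)"
    proof (rule integral_norm_bound_integral)
      fix s :: real assume "s \<in> {0<..}"
      hence s: "s > 0" by simp
      define u where "u = - (h / s)"
      have ker: "bessel_kernel \<nu> (y + h) s = bessel_kernel \<nu> y s * exp u"
        by (simp add: bessel_kernel_def u_def add_divide_distrib flip: exp_add)
      have ker1: "h * bessel_kernel (\<nu> - 1) y s = - (bessel_kernel \<nu> y s * u)"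
        using s by (simp add: bessel_kernel_def u_def powr_diff power2_eq_square)
      have "\<bar>u\<bar> \<le> (y / 2) / s"
        using h s by (simp add: u_def field_simps)
      hence e: "- s - y / s + \<bar>u\<bar> \<le> - s - (y / 2) / s"
        by (simp add: field_simps)
      have "?d s = bessel_kernel \<nu> y s * (exp u - 1 - u)"
        unfolding ker ker1 by (simp add: algebra_simps)
      hence "norm (?d s) = bessel_kernel \<nu> y s * \<bar>exp u - 1 - u\<bar>"
        by (simp add: abs_mult bessel_kernel_nonneg)
      also have "\<dots> \<le> bessel_kernel \<nu> y s * (u\<^sup>2 * exp \<bar>u\<bar>)"
        by (intro mult_left_mono exp_second_order_bound bessel_kernel_nonneg)
      also have "\<dots> = h\<^sup>2 * s powr (\<nu> - 3) * exp (- s - y / s + \<bar>u\<bar>)"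
      proof -
        have "s powr (\<nu> - 1) = s powr (\<nu> - 3) * s\<^sup>2"
          using s by (simp add: powr_diff power2_eq_square power3_eq_cube flip: powr_realpow)
        thus ?thesis using s unfolding bessel_kernel_def exp_add
          by (simp add: u_def power_divide)
      qed
      also have "\<dots> \<le> h\<^sup>2 * s powr (\<nu> - 3) * exp (- s - (y / 2) / s)"
        using e by (intro mult_left_mono) auto
      finally show "norm (?d s) \<le> h\<^sup>2 * bessel_kernel (\<nu> - 2) (y / 2) s"
        by (simp add: bessel_kernel_def mult_ac)
    qed (intro int integrable_add integrable_diff integrable_on_mult_right)+
    also have "integral {0<..} ?d = bessel_integral \<nu> (y + h) - bessel_integral \<nu> y + h * bessel_integral (\<nu> - 1) y"
      using int by (simp add: bessel_integral_def integral_add integral_diff integrable_diff integrable_on_mult_right)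
    finally have "\<bar>bessel_integral \<nu> (y + h) - bessel_integral \<nu> y + h * bessel_integral (\<nu> - 1) y\<bar> \<le> M * \<bar>h\<bar> * \<bar>h\<bar>"
      by (simp add: M_def bessel_integral_def mult_ac power2_eq_square)
    moreover have "(bessel_integral \<nu> (y + h) - bessel_integral \<nu> y) / h + bessel_integral (\<nu> - 1) y
        = (bessel_integral \<nu> (y + h) - bessel_integral \<nu> y + h * bessel_integral (\<nu> - 1) y) / h"
      using h by (simp add: field_simps)
    ultimately show ?thesis using h by (simp add: divide_le_eq abs_divide)
  qed
  have "((\<lambda>h. (bessel_integral \<nu> (y + h) - bessel_integral \<nu> y) / h + bessel_integral (\<nu> - 1) y) \<longlongrightarrow> 0) (at 0)"
  proof (rule Lim_null_comparison)
    show "\<forall>\<^sub>F h in at 0. norm ((bessel_integral \<nu> (y + h) - bessel_integral \<nu> y) / h + bessel_integral (\<nu> - 1) y) \<le> M * \<bar>h\<bar>"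
      unfolding eventually_at using y bound by (intro exI[of _ "y / 2"]) (auto simp: dist_norm)
    show "((\<lambda>h. M * \<bar>h\<bar>) \<longlongrightarrow> 0) (at 0)"
      by (auto intro!: tendsto_eq_intros)
  qed
  hence "((\<lambda>h. (bessel_integral \<nu> (y + h) - bessel_integral \<nu> y) / h) \<longlongrightarrow> - bessel_integral (\<nu> - 1) y) (at 0)"
    by (subst Lim_null) simp
  thus ?thesis unfolding DERIV_def .
qed

text \<open>The inversion \<open>s \<mapsto> y / s\<close> exchanges the two terms of the exponent.
  In Bessel terms this is the symmetry of K under a change of sign of the order.\<close>

lemma bessel_integral_uminus:
  assumes y: "y > 0"
  shows "bessel_integral (- \<mu>) y = y powr (- \<mu>) * bessel_integral \<mu> y"
proof -
  have img: "(\<lambda>s. y / s) ` {0<..} = {0<..}"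
  proof (intro equalityI subsetI)
    fix t :: real assume "t \<in> {0<..}"
    thus "t \<in> (\<lambda>s. y / s) ` {0<..}"
      using y by (intro image_eqI[of _ _ "y / t"]) auto
  qed (use y in auto)
  \<comment> \<open>The change of variables is an equivalence about a prescribed value of the
    integral; with \<open>bessel_integral \<mu> y\<close> as this value, its right-hand side is
    known.\<close>
  have "(\<lambda>x. \<bar>- y / x\<^sup>2\<bar> * bessel_kernel \<mu> y (y / x)) absolutely_integrable_on {0<..} \<and>
          integral {0<..} (\<lambda>x. \<bar>- y / x\<^sup>2\<bar> * bessel_kernel \<mu> y (y / x)) = bessel_integral \<mu> y
     \<longleftrightarrow> bessel_kernel \<mu> y absolutely_integrable_on ((\<lambda>s. y / s) ` {0<..}) \<and> 
       integral ((\<lambda>s. y / s) ` {0<..}) (bessel_kernel \<mu> y) = bessel_integral \<mu> y"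
    by (rule has_absolute_integral_change_of_variables_1')
       (use y in \<open>auto intro!: derivative_eq_intros simp: inj_on_def power2_eq_square\<close>)
  hence "integral {0<..} (\<lambda>x. \<bar>- y / x\<^sup>2\<bar> * bessel_kernel \<mu> y (y / x)) = bessel_integral \<mu> y"
    unfolding img using bessel_kernel_absolutely_integrable[of y \<mu>] y by (simp add: bessel_integral_def)
  also have "integral {0<..} (\<lambda>x. \<bar>- y / x\<^sup>2\<bar> * bessel_kernel \<mu> y (y / x))
      = integral {0<..} (\<lambda>s. y powr \<mu> * bessel_kernel (- \<mu>) y s)"
  proof (rule integral_cong)
    fix s :: real assume "s \<in> {0<..}"
    hence s: "s > 0" by simp
    have "y / s\<^sup>2 * (y / s) powr (\<mu> - 1) = y powr \<mu> * s powr (- \<mu> - 1)"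
      using s y by (simp add: powr_divide powr_diff powr_minus power2_eq_square field_simps)
    moreover have "- (y / s) - y / (y / s) = - s - y / s" using s y by simp
    ultimately show "\<bar>- y / s\<^sup>2\<bar> * bessel_kernel \<mu> y (y / s) = y powr \<mu> * bessel_kernel (- \<mu>) y s"
      using s y unfolding bessel_kernel_def
      by (metis (no_types, lifting) abs_div_pos abs_minus_cancel abs_of_pos minus_divide_left mult.assoc zero_less_power)
  qed
  also have "\<dots> = y powr \<mu> * bessel_integral (- \<mu>) y"
    by (simp add: bessel_integral_def)
  finally show ?thesis using y by (simp add: powr_minus field_simps)
qed

lemma bessel_integral_0:
  assumes "\<nu> > 0"
  shows "bessel_integral \<nu> 0 = Gamma \<nu>"
proof -
  have "bessel_kernel \<nu> 0 = (\<lambda>t. t powr (\<nu> - 1) / exp t)"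
    by (simp add: fun_eq_iff bessel_kernel_def exp_minus divide_inverse)
  thus ?thesis
    using integral_unique[OF Gamma_integral_real_open[OF assms]] by (simp add: bessel_integral_def)
qed

lemma bessel_integral_le_Gamma:
  assumes "\<nu> > 0" "y \<ge> 0"
  shows "bessel_integral \<nu> y \<le> Gamma \<nu>"
  unfolding bessel_integral_0[OF assms(1), symmetric] bessel_integral_def
  using assms by (intro integral_le bessel_kernel_integrable) (auto simp: bessel_kernel_def intro!: mult_left_mono)

text \<open>The bound \<open>1 - exp (- u) \<le> u powr (\<nu> / 2)\<close> at
  \<open>u = y / s\<close> splits the order in two: one half yields a power of \<open>y\<close> that
  vanishes at 0, the other keeps the integral over \<open>s\<close> convergent.\<close>

lemma tendsto_bessel_integral_0:
  assumes \<nu>: "0 < \<nu>" "\<nu> < 1"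
  shows "(bessel_integral \<nu> \<longlongrightarrow> Gamma \<nu>) (at_right 0)"
proof -
  have "\<bar>bessel_integral \<nu> y - Gamma \<nu>\<bar> \<le> Gamma (\<nu> / 2) * y powr (\<nu> / 2)" if y: "y > 0" for y
  proof -
    have int: "bessel_kernel \<nu> 0 integrable_on {0<..}" "bessel_kernel \<nu> y integrable_on {0<..}" 
       "bessel_kernel (\<nu> / 2) 0 integrable_on {0<..}"
      using y \<nu> by (auto intro!: bessel_kernel_integrable)
    have "bessel_integral \<nu> 0 - bessel_integral \<nu> y = integral {0<..} (\<lambda>s. bessel_kernel \<nu> 0 s - bessel_kernel \<nu> y s)"
      using int by (simp add: bessel_integral_def integral_diff)
    also have "\<dots> \<le> integral {0<..} (\<lambda>s. y powr (\<nu> / 2) * bessel_kernel (\<nu> / 2) 0 s)"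
    proof (intro integral_le integrable_diff integrable_on_mult_right int)
      fix s :: real assume "s \<in> {0<..}"
      hence s: "s > 0" by simp
      define u where "u = y / s"
      have u: "u > 0" using s y by (simp add: u_def)
      have "1 - exp (- u) \<le> u powr (\<nu> / 2)"
      proof (cases "u \<le> 1")
        case True
        have "1 - exp (- u) \<le> u" using exp_ge_add_one_self[of "- u"] by simp
        also have "u = u powr 1" using u by simp
        also have "\<dots> \<le> u powr (\<nu> / 2)"
          using u True \<nu> by (intro powr_mono') auto
        finally show ?thesis .
      next
        case False
        have "1 - exp (- u) \<le> 1" by simp
        also have "1 \<le> u powr (\<nu> / 2)" using False \<nu> by (intro ge_one_powr_ge_zero) auto
        finally show ?thesis .
      qed
      hence "bessel_kernel \<nu> 0 s * (1 - exp (- u)) \<le> bessel_kernel \<nu> 0 s * u powr (\<nu> / 2)"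
        by (intro mult_left_mono bessel_kernel_nonneg)
      also have "\<dots> = y powr (\<nu> / 2) * bessel_kernel (\<nu> / 2) 0 s"
      proof -
        have "s powr (\<nu> - 1) = s powr (\<nu> / 2 - 1) * s powr (\<nu> / 2)"
          by (simp flip: powr_add)
        thus ?thesis using s y by (simp add: bessel_kernel_def u_def powr_divide)
      qed
      also have "bessel_kernel \<nu> 0 s * (1 - exp (- u)) = bessel_kernel \<nu> 0 s - bessel_kernel \<nu> y s"
        by (simp add: bessel_kernel_def u_def algebra_simps flip: exp_add)
      finally show "bessel_kernel \<nu> 0 s - bessel_kernel \<nu> y s \<le> y powr (\<nu> / 2) * bessel_kernel (\<nu> / 2) 0 s" .
    qed
    also have "\<dots> = y powr (\<nu> / 2) * Gamma (\<nu> / 2)"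
      using \<nu> by (simp flip: bessel_integral_0 add: bessel_integral_def)
    finally show ?thesis using bessel_integral_le_Gamma[of \<nu> y] y \<nu> by (simp add: bessel_integral_0 mult_ac)
  qed
  hence "\<forall>\<^sub>F y in at_right 0. norm (bessel_integral \<nu> y - Gamma \<nu>) \<le> Gamma (\<nu> / 2) * y powr (\<nu> / 2)"
    by (simp add: eventually_at_right_less eventually_mono[OF eventually_at_right_less])
  moreover have "((\<lambda>y. Gamma (\<nu> / 2) * y powr (\<nu> / 2)) \<longlongrightarrow> 0) (at_right 0)"
    using \<nu> by (auto intro!: tendsto_eq_intros simp: eventually_at_right_less eventually_mono[OF eventually_at_right_less])
  ultimately have "((\<lambda>y. bessel_integral \<nu> y - Gamma \<nu>) \<longlongrightarrow> 0) (at_right 0)"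
    by (rule Lim_null_comparison)
  thus ?thesis by (rule Lim_null[THEN iffD2])
qed

section \<open>The connection formula and the Mellin transform\<close>

lemma Gamma_reflection_real:
  fixes x :: real
  shows "Gamma x * Gamma (1 - x) = pi / sin (pi * x)"
proof -
  have "complex_of_real (Gamma x * Gamma (1 - x)) = Gamma (complex_of_real x) * Gamma (1 - complex_of_real x)"
    using Gamma_complex_of_real[of x] Gamma_complex_of_real[of "1 - x"] by simp
  also have "\<dots> = complex_of_real (pi / sin (pi * x))"
    unfolding Gamma_reflection_complex by (simp flip: sin_of_real)
  finally show ?thesis unfolding of_real_eq_iff .
qed

lemma eq_0_if_derivative_0_tendsto_0:
  fixes f :: "real \<Rightarrow> real"
  assumes "\<And>y. y > 0 \<Longrightarrow> (f has_real_derivative 0) (at y)"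
    and "(f \<longlongrightarrow> 0) (at_right 0)" and x: "x > 0"
  shows "f x = 0"
proof -
  have const: "f y = f x" if "y > 0" for y
    using x that assms(1)
    by (intro DERIV_isconst3[of 0 "x + y + 1" y x f]) auto
  have "\<forall>\<^sub>F y in at_right 0. f y = f x"
    using const by (intro eventually_mono[OF eventually_at_right_less]) auto
  hence "(f \<longlongrightarrow> f x) (at_right 0)"
    by (rule tendsto_eventually)
  thus ?thesis using assms(2) tendsto_unique[of "at_right 0" f "f x" 0] by simp
qed

lemma reg_0F1_0: "reg_0F1 c 0 = rGamma c"
  unfolding reg_0F1_def by (subst powser_zero) simp

lemma isCont_reg_0F1: "isCont (reg_0F1 c) y"
  using has_real_derivative_reg_0F1 by (rule DERIV_isCont)

lemma isCont_reg_1F2: "isCont (reg_1F2 a c) y"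
  using has_real_derivative_reg_1F2 by (rule DERIV_isCont)

lemma tendsto_reg_0F1_0: "(reg_0F1 c \<longlongrightarrow> rGamma c) (at_right 0)"
proof -
  have "(reg_0F1 c \<longlongrightarrow> rGamma c) (at 0)"
    using isCont_reg_0F1[where c = c and y = 0] by (simp add: isCont_def reg_0F1_0)
  thus ?thesis by (rule tendsto_within_subset) simp
qed

lemma tendsto_powr_0: "a > 0 \<Longrightarrow> ((\<lambda>y::real. y powr a) \<longlongrightarrow> 0) (at_right 0)"
  by (auto intro!: tendsto_eq_intros simp: eventually_mono[OF eventually_at_right_less])

text \<open>The formula for K in terms of I. The difference \<open>D\<close> of the two sides, at
  the orders \<open>\<nu>\<close> and \<open>1 - \<nu>\<close>, solves a homogeneous linear system
  and vanishes at 0. The coefficients of the system are singular there, so uniqueness comes from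
  reduction of order by the positive solution \<open>reg_0F1 (1 - \<nu>)\<close>.\<close>

theorem bessel_integral_eq_reg_0F1:
  assumes \<nu>: "0 < \<nu>" "\<nu> < 1" and y: "y > 0"
  shows "bessel_integral \<nu> y = pi / sin (pi * \<nu>) * (reg_0F1 (1 - \<nu>) y - y powr \<nu> * reg_0F1 (1 + \<nu>) y)"
proof -
  define C where "C = pi / sin (pi * \<nu>)"
  define D where "D = (\<lambda>\<mu> y. bessel_integral \<mu> y - C * (reg_0F1 (1 - \<mu>) y - y powr \<mu> * reg_0F1 (\<mu> + 1) y))"
  have C: "C = Gamma \<mu> * Gamma (1 - \<mu>)" if "\<mu> \<in> {\<nu>, 1 - \<nu>}" for \<mu>
    using that Gamma_reflection_real[of \<nu>] by (auto simp: C_def mult_ac)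
  have lim: "(D \<mu> \<longlongrightarrow> 0) (at_right 0)" if "\<mu> \<in> {\<nu>, 1 - \<nu>}" for \<mu>
  proof -
    have \<mu>: "0 < \<mu>" "\<mu> < 1" using that \<nu> by auto
    have "Gamma (1 - \<mu>) > 0" using \<mu> by (intro Gamma_real_pos) auto
    \<comment> \<open>The constant \<open>C\<close>, common to both orders, makes the limits of the
      two sides at 0 agree.\<close>
    hence CG: "C * rGamma (1 - \<mu>) = Gamma \<mu>"
      using C[OF that] by (simp add: rGamma_inverse_Gamma)
    have "(D \<mu> \<longlongrightarrow> Gamma \<mu> - C * (rGamma (1 - \<mu>) - 0 * rGamma (\<mu> + 1))) (at_right 0)"
      unfolding D_def using \<mu>
      by (intro tendsto_intros tendsto_bessel_integral_0 tendsto_reg_0F1_0 tendsto_powr_0)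
    thus ?thesis using CG by simp
  qed
  have deriv: "(D \<mu> has_real_derivative - (y powr (\<mu> - 1) * D (1 - \<mu>) y)) (at y)" if "y > 0" for \<mu> y
  proof -
    have d: "(D \<mu> has_real_derivative - bessel_integral (\<mu> - 1) y
        - C * (reg_0F1 (1 - \<mu> + 1) y - y powr (\<mu> - 1) * reg_0F1 \<mu> y)) (at y)"
      unfolding D_def using that
      by (intro DERIV_diff DERIV_cmult has_real_derivative_bessel_integral has_real_derivative_reg_0F1
            has_real_derivative_powr_reg_0F1)
    \<comment> \<open>Differentiation leads to the order \<open>\<mu> - 1\<close>; the inversion
      returns it to \<open>1 - \<mu>\<close>, which closes the system.\<close>
    have u: "bessel_integral (\<mu> - 1) y = y powr (\<mu> - 1) * bessel_integral (1 - \<mu>) y"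
      using bessel_integral_uminus[OF that, of "1 - \<mu>"] by simp
    have e: "y powr (\<mu> - 1) * D (1 - \<mu>) y = y powr (\<mu> - 1) * bessel_integral (1 - \<mu>) y
        - C * (y powr (\<mu> - 1) * reg_0F1 \<mu> y - reg_0F1 (1 - \<mu> + 1) y)"
    proof -
      have one: "y powr (\<mu> - 1) * y powr (1 - \<mu>) = 1"
        using that by (simp flip: powr_add)
      have "y powr (\<mu> - 1) * D (1 - \<mu>) y = y powr (\<mu> - 1) * bessel_integral (1 - \<mu>) y
          - C * (y powr (\<mu> - 1) * reg_0F1 \<mu> y - (y powr (\<mu> - 1) * y powr (1 - \<mu>)) * reg_0F1 (1 - \<mu> + 1) y)"
        unfolding D_def by (simp add: algebra_simps)
      thus ?thesis unfolding one by simp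
    qed
    show ?thesis
      using d unfolding u e by (simp add: algebra_simps)
  qed
  let ?f = "reg_0F1 (1 - \<nu>)" and ?f' = "reg_0F1 (2 - \<nu>)"
  have f_pos: "?f y > 0" if "y > 0" for y using \<nu> that by (intro reg_0F1_pos) auto
  \<comment> \<open>\<open>w\<close> is, up to sign, \<open>y powr (1 - \<nu>)\<close> times the Wronskian of \<open>?f\<close> and \<open>D \<nu>\<close>.\<close>
  define w where "w = (\<lambda>y. ?f y * D (1 - \<nu>) y + (y powr (1 - \<nu>) * ?f' y) * D \<nu> y)"
  \<comment> \<open>\<open>w\<close> is the determinant of two solutions of a system with zero
    diagonal, so the terms of its derivative cancel in pairs.\<close>
  have w0: "w y = 0" if y: "y > 0" for y
  proof (rule eq_0_if_derivative_0_tendsto_0[OF _ _ that])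
    fix y :: real assume y: "y > 0"
    have 2: "y powr (1 - \<nu>) * y powr (\<nu> - 1) = 1"
      using y by (simp flip: powr_add)
    have d: "(w has_real_derivative
          (?f' y * D (1 - \<nu>) y + - (y powr (- \<nu>) * D \<nu> y) * ?f y)
          + (y powr (- \<nu>) * ?f y * D \<nu> y + - (y powr (\<nu> - 1) * D (1 - \<nu>) y) * (y powr (1 - \<nu>) * ?f' y))) (at y)"
      unfolding w_def
      using deriv[OF y, of \<nu>] deriv[OF y, of "1 - \<nu>"] has_real_derivative_reg_0F1[of "1 - \<nu>" y] has_real_derivative_powr_reg_0F1[OF y, of "1 - \<nu>"]
      by (intro DERIV_add DERIV_mult) (simp_all add: algebra_simps)
    have "(y powr (\<nu> - 1) * D (1 - \<nu>) y) * (y powr (1 - \<nu>) * ?f' y) = (y powr (1 - \<nu>) * y powr (\<nu> - 1)) * (?f' y * D (1 - \<nu>) y)"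
      by (simp add: mult_ac)
    also have "\<dots> = ?f' y * D (1 - \<nu>) y" unfolding 2 by simp
    finally have e: "(y powr (\<nu> - 1) * D (1 - \<nu>) y) * (y powr (1 - \<nu>) * ?f' y) = ?f' y * D (1 - \<nu>) y" .
    show "(w has_real_derivative 0) (at y)"
      using d unfolding mult_minus_left e by (simp add: mult_ac)
  next
    have "(w \<longlongrightarrow> rGamma (1 - \<nu>) * 0 + (0 * rGamma (2 - \<nu>)) * 0) (at_right 0)"
      unfolding w_def using \<nu> by (intro tendsto_intros lim tendsto_reg_0F1_0 tendsto_powr_0) auto
    thus "(w \<longlongrightarrow> 0) (at_right 0)" by simp
  qed
  \<comment> \<open>The derivative of this quotient is \<open>- (y powr (\<nu> - 1) * w y)\<close>
    divided by the square of \<open>?f y\<close>, hence 0.\<close>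
  have "D \<nu> y / ?f y = 0"
  proof (rule eq_0_if_derivative_0_tendsto_0[OF _ _ y])
    fix y :: real assume y: "y > 0"
    have "y powr (\<nu> - 1) * w y = 0" using w0[OF y] by simp
    moreover have "y powr (\<nu> - 1) * w y = y powr (\<nu> - 1) * D (1 - \<nu>) y * ?f y + (y powr (\<nu> - 1) * y powr (1 - \<nu>)) * (D \<nu> y * ?f' y)"
      unfolding w_def by (simp add: algebra_simps)
    moreover have "y powr (\<nu> - 1) * y powr (1 - \<nu>) = 1"
      using y by (simp flip: powr_add)
    ultimately have "- (y powr (\<nu> - 1) * D (1 - \<nu>) y) * ?f y - D \<nu> y * ?f' y = 0"
      by simp
    moreover have "((\<lambda>y. D \<nu> y / ?f y) has_real_derivative
        (- (y powr (\<nu> - 1) * D (1 - \<nu>) y) * ?f y - D \<nu> y * ?f' y) / (?f y * ?f y)) (at y)"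
      using deriv[OF y, of \<nu>] has_real_derivative_reg_0F1[of "1 - \<nu>" y] f_pos[OF y]
      by (intro DERIV_divide) (simp_all add: algebra_simps)
    ultimately show "((\<lambda>y. D \<nu> y / ?f y) has_real_derivative 0) (at y)" by simp
  next
    have "Gamma (1 - \<nu>) > 0" using \<nu> by (intro Gamma_real_pos) auto
    hence "((\<lambda>y. D \<nu> y / ?f y) \<longlongrightarrow> 0 / rGamma (1 - \<nu>)) (at_right 0)"
      by (intro tendsto_intros lim tendsto_reg_0F1_0) (auto simp: rGamma_inverse_Gamma)
    thus "((\<lambda>y. D \<nu> y / ?f y) \<longlongrightarrow> 0) (at_right 0)" by simp
  qed
  thus ?thesis using f_pos[OF y] by (simp add: D_def C_def add_ac)
qed

section \<open>The Mellin transform of the integral representation\<close>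

lemma nn_integral_powr_exp:
  assumes "\<alpha> > 0" "s > 0"
  shows "(\<integral>\<^sup>+y. ennreal (indicator {0<..} y * (y powr (\<alpha> - 1) * exp (- y / s))) \<partial>lborel) = ennreal (s powr \<alpha> * Gamma \<alpha>)"
proof -
  have "(\<integral>\<^sup>+y. ennreal (indicator {0<..} y * (y powr (\<alpha> - 1) * exp (- y / s))) \<partial>lborel)
      = ennreal s * (\<integral>\<^sup>+t. ennreal (indicator {0<..} (s * t) * ((s * t) powr (\<alpha> - 1) * exp (- t))) \<partial>lborel)"
    using assms by (subst nn_integral_real_affine[where c = s and t = 0]) auto
  also have "(\<lambda>t. ennreal (indicator {0<..} (s * t) * ((s * t) powr (\<alpha> - 1) * exp (- t))))
      = (\<lambda>t. ennreal (s powr (\<alpha> - 1)) * ennreal (indicator {0<..} t * (t powr (\<alpha> - 1) / exp t)))"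
    using assms by (auto simp: fun_eq_iff indicator_def zero_less_mult_iff powr_mult exp_minus divide_inverse
         simp flip: ennreal_mult')
  also have "ennreal s * (\<integral>\<^sup>+t. \<dots> t \<partial>lborel) = ennreal s * (ennreal (s powr (\<alpha> - 1)) * ennreal (Gamma \<alpha>))"
    using nn_integral_has_integral_lebesgue[OF _ Gamma_integral_real_open[OF assms(1)]]
    by (subst nn_integral_cmult) auto
  also have "\<dots> = ennreal (s powr \<alpha> * Gamma \<alpha>)"
    using assms by (simp add: powr_diff less_imp_le flip: ennreal_mult' )
  finally show ?thesis .
qed

text \<open>By Tonelli the integral over \<open>y\<close> may be taken first. It gives
  \<open>s powr \<alpha> * Gamma \<alpha>\<close>, and a Gamma integral of order
  \<open>\<nu> + \<alpha>\<close> remains. All integrands are nonnegative, so integrability follows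
  from the finite value.\<close>

lemma mellin_bessel_integral:
  assumes \<alpha>: "\<alpha> > 0" "\<nu> + \<alpha> > 0"
  defines "f \<equiv> \<lambda>y. indicator {0<..} y * (y powr (\<alpha> - 1) * bessel_integral \<nu> y)"
  shows "has_bochner_integral lborel f (Gamma \<alpha> * Gamma (\<nu> + \<alpha>))"
proof (rule has_bochner_integral_nn_integral)
  have "continuous_on {0<..} (\<lambda>y. y powr (\<alpha> - 1) * bessel_integral \<nu> y)"
    using has_real_derivative_bessel_integral
    by (intro continuous_intros DERIV_continuous_on[of _ "bessel_integral \<nu>"])
       (auto intro: has_field_derivative_at_within)
  thus "f \<in> borel_measurable lborel"
    unfolding f_def using borel_measurable_continuous_on_indicator[of "{0<..}" "\<lambda>y. y powr (\<alpha> - 1) * bessel_integral \<nu> y"]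
    by simp
  show "AE y in lborel. 0 \<le> f y"
    by (simp add: f_def bessel_integral_nonneg)
  show "0 \<le> Gamma \<alpha> * Gamma (\<nu> + \<alpha>)"
    using \<alpha> by (simp add: less_imp_le)
  let ?g = "\<lambda>s y. ennreal (indicator {0<..} s * (s powr (\<nu> - 1) / exp s)) *
      ennreal (indicator {0<..} y * (y powr (\<alpha> - 1) * exp (- y / s)))"
  have "(\<integral>\<^sup>+y. ennreal (f y) \<partial>lborel) = (\<integral>\<^sup>+y. (\<integral>\<^sup>+s. ?g s y \<partial>lborel) \<partial>lborel)"
  proof (rule nn_integral_cong)
    fix y :: real
    show "ennreal (f y) = (\<integral>\<^sup>+s. ?g s y \<partial>lborel)"
    proof (cases "y > 0")
      case True
      have g: "?g s y = ennreal (y powr (\<alpha> - 1)) * ennreal (indicator {0<..} s * bessel_kernel \<nu> y s)" for s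
        using True by (auto simp: indicator_def bessel_kernel_def exp_diff exp_minus divide_inverse mult_ac simp flip: ennreal_mult')
      have "(bessel_kernel \<nu> y has_integral bessel_integral \<nu> y) {0<..}"
        unfolding bessel_integral_def using True by (intro integrable_integral bessel_kernel_integrable) auto
      hence "(\<integral>\<^sup>+s. ennreal (indicator {0<..} s * bessel_kernel \<nu> y s) \<partial>lborel) = ennreal (bessel_integral \<nu> y)"
        by (intro nn_integral_has_integral_lebesgue bessel_kernel_nonneg)
      thus ?thesis unfolding g
        using True by (subst nn_integral_cmult) (auto simp: f_def bessel_kernel_def bessel_integral_nonneg simp flip: ennreal_mult')
    qed (simp add: f_def)
  qed
  also have "\<dots> = (\<integral>\<^sup>+s. (\<integral>\<^sup>+y. ?g s y \<partial>lborel) \<partial>lborel)"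
    by (rule lborel_pair.Fubini') (simp add: split_beta')
  also have "\<dots> = (\<integral>\<^sup>+s. ennreal (Gamma \<alpha>) * ennreal (indicator {0<..} s * (s powr (\<nu> + \<alpha> - 1) / exp s)) \<partial>lborel)"
  proof (rule nn_integral_cong)
    fix s :: real
    show "(\<integral>\<^sup>+y. ?g s y \<partial>lborel) = ennreal (Gamma \<alpha>) * ennreal (indicator {0<..} s * (s powr (\<nu> + \<alpha> - 1) / exp s))"
    proof (cases "s > 0")
      case True
      have "s powr (\<nu> + \<alpha> - 1) = s powr (\<nu> - 1) * s powr \<alpha>" by (simp flip: powr_add add: algebra_simps)
      moreover have "(\<integral>\<^sup>+y. ?g s y \<partial>lborel) = ennreal (indicator {0<..} s * (s powr (\<nu> - 1) / exp s)) * ennreal (s powr \<alpha> * Gamma \<alpha>)"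
        unfolding nn_integral_powr_exp[OF \<alpha>(1) True, symmetric] by (rule nn_integral_cmult) simp
      ultimately show ?thesis using True \<alpha>
        by (simp add: less_imp_le mult_ac flip: ennreal_mult')
    qed simp
  qed
  also have "\<dots> = ennreal (Gamma \<alpha>) * ennreal (Gamma (\<nu> + \<alpha>))"
    using nn_integral_has_integral_lebesgue[OF _ Gamma_integral_real_open[OF \<alpha>(2)]]
    by (subst nn_integral_cmult) auto
  also have "\<dots> = ennreal (Gamma \<alpha> * Gamma (\<nu> + \<alpha>))"
    using \<alpha> by (simp add: less_imp_le ennreal_mult')
  finally show "(\<integral>\<^sup>+y. ennreal (f y) \<partial>lborel) = ennreal (Gamma \<alpha> * Gamma (\<nu> + \<alpha>))" .
qed

section \<open>The orders 1/3, 2/3 and 5/3\<close>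

lemma sin_pi_third: "sin (pi * (1 / 3)) = sqrt 3 / 2" "sin (pi * (2 / 3)) = sqrt 3 / 2"
  using sin_60 sin_120 by (simp_all add: mult.commute)

lemma Gamma_third: "Gamma (1 / 3) * Gamma (2 / 3 :: real) = 2 * pi / sqrt 3"
  using Gamma_reflection_real[of "1 / 3"] by (simp add: sin_60)

text \<open>\<open>int_K13 (x\<^sup>2 / 4)\<close> is the integral of \<open>K\<^sub>1\<^sub>/\<^sub>3\<close> from 0 to \<open>x\<close>.\<close>

definition int_K13 :: "real \<Rightarrow> real" where
  "int_K13 y = pi / sqrt 3 * (y powr (1 / 3) * reg_1F2 (1 / 3) (2 / 3) y - y powr (2 / 3) * reg_1F2 (2 / 3) (4 / 3) y)"

lemma bessel_integral_thirds:
  assumes "y > 0"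
  shows "bessel_integral (1 / 3) y = 2 * (pi / sqrt 3) * (reg_0F1 (2 / 3) y - y powr (1 / 3) * reg_0F1 (4 / 3) y)"
    and "bessel_integral (2 / 3) y = 2 * (pi / sqrt 3) * (reg_0F1 (1 / 3) y - y powr (2 / 3) * reg_0F1 (5 / 3) y)"
proof -
  have C: "pi / sin (pi * (1 / 3)) = 2 * (pi / sqrt 3)" "pi / sin (pi * (2 / 3)) = 2 * (pi / sqrt 3)"
    unfolding sin_pi_third by simp_all
  show "bessel_integral (1 / 3) y = 2 * (pi / sqrt 3) * (reg_0F1 (2 / 3) y - y powr (1 / 3) * reg_0F1 (4 / 3) y)"
    using bessel_integral_eq_reg_0F1[of "1 / 3" y] assms unfolding C by simp
  show "bessel_integral (2 / 3) y = 2 * (pi / sqrt 3) * (reg_0F1 (1 / 3) y - y powr (2 / 3) * reg_0F1 (5 / 3) y)"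
    using bessel_integral_eq_reg_0F1[of "2 / 3" y] assms unfolding C by simp
qed

text \<open>With \<open>y = x^2 / 4\<close> one has \<open>dx = y powr (- 1 / 2) dy\<close>, so the
  right-hand side is K of order 1/3 in the variable \<open>y\<close>.\<close>

lemma has_real_derivative_int_K13:
  assumes y: "y > 0"
  shows "(int_K13 has_real_derivative y powr (- 2 / 3) * bessel_integral (1 / 3) y / 2) (at y)"
proof -
  have "(int_K13 has_real_derivative pi / sqrt 3 * (y powr (1 / 3 - 1) * reg_0F1 (2 / 3) y
      - y powr (2 / 3 - 1) * reg_0F1 (4 / 3) y)) (at y)"
    unfolding int_K13_def
    by (intro DERIV_cmult DERIV_diff has_real_derivative_powr_reg_1F2 y) (simp_all add: add_eq_0_iff)
  moreover have "y powr (- 2 / 3) * bessel_integral (1 / 3) y / 2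
      = pi / sqrt 3 * (y powr (- 2 / 3) * reg_0F1 (2 / 3) y - (y powr (- 2 / 3) * y powr (1 / 3)) * reg_0F1 (4 / 3) y)"
    unfolding bessel_integral_thirds(1)[OF y]
    by (simp add: algebra_simps diff_divide_distrib del: times_divide_eq_left times_divide_eq_right)
  moreover have "y powr (- 2 / 3) * y powr (1 / 3) = y powr (2 / 3 - 1)"
    unfolding powr_add[symmetric] by simp
  ultimately show ?thesis by simp
qed

text \<open>The Mellin transform at \<open>\<nu> = \<alpha> = 1 / 3\<close> is
  \<open>Gamma (1 / 3) * Gamma (2 / 3)\<close>, and \<open>int_K13\<close> is half of the truncated
  integral.\<close>

lemma tendsto_int_K13: "(int_K13 \<longlongrightarrow> pi / sqrt 3) at_top"
proof -
  define f :: "real \<Rightarrow> real" where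
    "f = (\<lambda>y. indicator {0<..} y * (y powr (- 2 / 3) * bessel_integral (1 / 3) y))"
  have f: "has_bochner_integral lborel f (2 * pi / sqrt 3)"
    using mellin_bessel_integral[of "1 / 3" "1 / 3"] by (simp add: Gamma_third f_def)
  have int: "integrable lborel f" using f by (simp add: has_bochner_integral_iff)
  have "((\<lambda>b. \<integral>y. indicator {..b} y *\<^sub>R f y \<partial>lborel) \<longlongrightarrow> 2 * pi / sqrt 3) at_top"
    using tendsto_integral_at_top[OF sets_lborel int] unfolding has_bochner_integral_integral_eq[OF f] .
  moreover have "(\<integral>y. indicator {..b} y *\<^sub>R f y \<partial>lborel) = 2 * int_K13 b" if b: "b \<ge> 0" for b
  proof -
    have "integrable lborel (\<lambda>y. indicator {..b} y *\<^sub>R f y)"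
      using int by (intro integrable_mult_indicator) auto
    hence 1: "((\<lambda>y. indicator {..b} y *\<^sub>R f y) has_integral (\<integral>y. indicator {..b} y *\<^sub>R f y \<partial>lborel)) UNIV"
      by (rule has_integral_integral_lborel)
    have "(f has_integral (2 * int_K13 b - 2 * int_K13 0)) {0..b}"
    \<comment> \<open>The derivative is available only inside the interval; at 0 continuity and the
      value \<open>int_K13 0 = 0\<close> suffice.\<close>
    proof (rule fundamental_theorem_of_calculus_interior[OF b])
      show "continuous_on {0..b} (\<lambda>y. 2 * int_K13 y)"
      proof -
        have "continuous_on {0..b} (reg_1F2 a c)" for a c
          by (simp add: continuous_at_imp_continuous_on isCont_reg_1F2)
        moreover have "continuous_on {0..b} (\<lambda>y. y powr a)" if "a > 0" for a :: real
          using that by (intro continuous_on_powr' continuous_intros) auto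
        ultimately show ?thesis
          unfolding int_K13_def by (intro continuous_on_mult continuous_on_diff continuous_on_const) simp_all
      qed
      fix y assume "y \<in> {0<..<b}"
      hence "y > 0" by simp
      from DERIV_cmult[OF has_real_derivative_int_K13[OF this], of 2] \<open>y > 0\<close>
      show "((\<lambda>y. 2 * int_K13 y) has_vector_derivative f y) (at y)"
        by (simp add: f_def flip: has_real_derivative_iff_has_vector_derivative)
    qed
    hence "((\<lambda>y. if y \<in> {0..b} then f y else 0) has_integral (2 * int_K13 b)) UNIV"
      by (subst has_integral_restrict_UNIV) (simp add: int_K13_def)
    moreover have "(\<lambda>y. if y \<in> {0..b} then f y else 0) = (\<lambda>y. indicator {..b} y *\<^sub>R f y)"
      by (auto simp: fun_eq_iff f_def indicator_def)
    ultimately show ?thesis using has_integral_unique[OF 1] by simp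
  qed
  hence "\<forall>\<^sub>F b in at_top. (\<integral>y. indicator {..b} y *\<^sub>R f y \<partial>lborel) = 2 * int_K13 b"
    by (intro eventually_at_top_linorderI[of 0]) auto
  ultimately have "((\<lambda>b. 2 * int_K13 b) \<longlongrightarrow> 2 * pi / sqrt 3) at_top"
    by (rule Lim_transform_eventually)
  from tendsto_mult_left[OF this, of "1 / 2"] show ?thesis by simp
qed

text \<open>
  \<open>int_K53 (x\<^sup>2 / 4)\<close> is an antiderivative of \<open>- K\<^sub>5\<^sub>/\<^sub>3\<close> that does not vanish at
  infinity; the integral from \<open>x\<close> to infinity is smaller by \<open>pi / sqrt 3\<close>.
\<close>

definition int_K53 :: "real \<Rightarrow> real" where
  "int_K53 y = pi / sqrt 3 * (y powr (- 1 / 3) * reg_1F2 (- 1 / 3) (- 2 / 3) y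
      - y powr (4 / 3) * reg_1F2 (4 / 3) (8 / 3) y)"

lemma third_not_int: "real n + - 1 / 3 \<noteq> 0"
proof
  assume "real n + - 1 / 3 = 0"
  hence "real (3 * n) = real 1" by simp
  thus False unfolding of_nat_eq_iff by presburger
qed

text \<open>The first summand is twice K of order 2/3. The contiguous relation enters at
  \<open>a = - 1 / 3\<close> and at \<open>a = 1 / 3\<close>. This form makes monotonicity and the
  limit at infinity accessible.\<close>

lemma int_K53_eq:
  assumes y: "y > 0"
  shows "int_K53 y = y powr (- 1 / 3) * bessel_integral (2 / 3) y + int_K13 y"
proof -
  have c1: "reg_1F2 (- 1 / 3) (- 2 / 3) y + y * reg_1F2 (2 / 3) (4 / 3) y = 2 * reg_0F1 (1 / 3) y"
    using reg_1F2_contiguous[of "- 1 / 3" y, OF third_not_int] by simp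
  have c2: "reg_1F2 (1 / 3) (2 / 3) y + y * reg_1F2 (4 / 3) (8 / 3) y = 2 * reg_0F1 (5 / 3) y"
    using reg_1F2_contiguous[of "1 / 3" y] by (simp add: add_eq_0_iff)
  have p: "y powr (2 / 3) = y powr (- 1 / 3) * y" "y powr (4 / 3) = y powr (1 / 3) * y"
    using y powr_add[of y "- 1 / 3" 1] powr_add[of y "1 / 3" 1] by simp_all
  have p3: "y powr (- 1 / 3) * y powr (2 / 3) = y powr (1 / 3)"
    unfolding powr_add[symmetric] by simp
  have "y powr (- 1 / 3) * bessel_integral (2 / 3) y + int_K13 y
      = pi / sqrt 3 * (y powr (- 1 / 3) * (2 * reg_0F1 (1 / 3) y) - (y powr (- 1 / 3) * y powr (2 / 3)) * (2 * reg_0F1 (5 / 3) y)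
         + y powr (1 / 3) * reg_1F2 (1 / 3) (2 / 3) y - y powr (2 / 3) * reg_1F2 (2 / 3) (4 / 3) y)"
    unfolding bessel_integral_thirds(2)[OF y] int_K13_def
    by (simp add: algebra_simps del: times_divide_eq_left times_divide_eq_right)
  also have "\<dots> = int_K53 y"
    unfolding p3 unfolding p int_K53_def c1[symmetric] c2[symmetric]
    by (simp add: algebra_simps del: times_divide_eq_left times_divide_eq_right)
  finally show ?thesis ..
qed

lemma has_real_derivative_int_K53:
  assumes y: "y > 0"
  shows "(int_K53 has_real_derivative
      pi / sqrt 3 * (y powr (- 4 / 3) * reg_0F1 (- 2 / 3) y - y powr (1 / 3) * reg_0F1 (8 / 3) y)) (at y)"
proof -
  have "(int_K53 has_real_derivative
      pi / sqrt 3 * (y powr (- 1 / 3 - 1) * reg_0F1 (- 2 / 3) y - y powr (4 / 3 - 1) * reg_0F1 (8 / 3) y)) (at y)"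
    unfolding int_K53_def
    by (intro DERIV_cmult DERIV_diff has_real_derivative_powr_reg_1F2 y third_not_int) (simp add: add_eq_0_iff)
  thus ?thesis by simp
qed

text \<open>This gives the sign of K of order 5/3. Differentiating the form in
  \<open>int_K53_eq\<close> expresses the derivative through two nonnegative integrals.\<close>

lemma int_K53_deriv_nonpos:
  assumes y: "y > 0"
  shows "y powr (- 4 / 3) * reg_0F1 (- 2 / 3) y - y powr (1 / 3) * reg_0F1 (8 / 3) y \<le> 0"
proof -
  have "((\<lambda>y. y powr (- 1 / 3) * bessel_integral (2 / 3) y + int_K13 y) has_real_derivative
      (- 1 / 3 * y powr (- 1 / 3 - 1) * bessel_integral (2 / 3) y + - bessel_integral (2 / 3 - 1) y * y powr (- 1 / 3))
       + y powr (- 2 / 3) * bessel_integral (1 / 3) y / 2) (at y)" (is "(_ has_real_derivative ?d) _")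
    using y by (intro DERIV_add DERIV_mult has_real_derivative_bessel_integral has_real_derivative_int_K13
        has_real_derivative_powr) 
  moreover have "\<forall>\<^sub>F t in nhds y. int_K53 t = t powr (- 1 / 3) * bessel_integral (2 / 3) t + int_K13 t"
    using eventually_nhds_in_open[of "{0<..}" y] y by (auto elim!: eventually_mono simp: int_K53_eq)
  ultimately have "(int_K53 has_real_derivative ?d) (at y)"
    by (subst DERIV_cong_ev[OF refl _ refl])
  hence "pi / sqrt 3 * (y powr (- 4 / 3) * reg_0F1 (- 2 / 3) y - y powr (1 / 3) * reg_0F1 (8 / 3) y) = ?d"
    using has_real_derivative_int_K53[OF y] by (rule DERIV_unique[symmetric])
  \<comment> \<open>After the inversion the integral of order 1/3 occurs with the coefficients -1
    and 1/2, so the negative one prevails.\<close>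
  also have "bessel_integral (2 / 3 - 1) y = y powr (- 1 / 3) * bessel_integral (1 / 3) y"
    using bessel_integral_uminus[OF y, of "1 / 3"] by simp
  also have "- (y powr (- 1 / 3) * bessel_integral (1 / 3) y) * y powr (- 1 / 3)
      = - (y powr (- 2 / 3) * bessel_integral (1 / 3) y)"
    by (simp flip: powr_add add: mult_ac)
  finally have "pi / sqrt 3 * (y powr (- 4 / 3) * reg_0F1 (- 2 / 3) y - y powr (1 / 3) * reg_0F1 (8 / 3) y)
      = - (y powr (- 4 / 3) * bessel_integral (2 / 3) y / 3 + y powr (- 2 / 3) * bessel_integral (1 / 3) y / 2)"
    by simp
  also have "\<dots> \<le> 0"
  proof -
    have "0 \<le> y powr (- 4 / 3) * bessel_integral (2 / 3) y" "0 \<le> y powr (- 2 / 3) * bessel_integral (1 / 3) y"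
      by (simp_all add: bessel_integral_nonneg)
    thus ?thesis by linarith
  qed
  finally show ?thesis by (simp add: mult_le_0_iff zero_le_divide_iff divide_le_0_iff)
      (smt (verit) pi_gt_zero)
qed

text \<open>The integral of order 2/3 is bounded by \<open>Gamma (2 / 3)\<close>, so its term decays
  and the limit of \<open>int_K13\<close> remains.\<close>

lemma tendsto_int_K53: "(int_K53 \<longlongrightarrow> pi / sqrt 3) at_top"
proof -
  have "((\<lambda>y. y powr (- 1 / 3) * bessel_integral (2 / 3) y) \<longlongrightarrow> 0) at_top"
  proof (rule Lim_null_comparison)
    show "\<forall>\<^sub>F y in at_top. norm (y powr (- 1 / 3) * bessel_integral (2 / 3) y) \<le> y powr (- 1 / 3) * Gamma (2 / 3)"
      by (intro eventually_at_top_linorderI[of 0])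
         (auto simp: abs_mult bessel_integral_nonneg intro!: mult_left_mono bessel_integral_le_Gamma)
    have "((\<lambda>y::real. y powr (- 1 / 3)) \<longlongrightarrow> 0) at_top"
      by (intro tendsto_neg_powr filterlim_ident) simp
    from tendsto_mult_right[OF this, of "Gamma (2 / 3)"]
    show "((\<lambda>y::real. y powr (- 1 / 3) * Gamma (2 / 3)) \<longlongrightarrow> 0) at_top" by simp
  qed
  from tendsto_add[OF this tendsto_int_K13]
  have "((\<lambda>y. y powr (- 1 / 3) * bessel_integral (2 / 3) y + int_K13 y) \<longlongrightarrow> pi / sqrt 3) at_top"
    by simp
  moreover have "\<forall>\<^sub>F y in at_top. y powr (- 1 / 3) * bessel_integral (2 / 3) y + int_K13 y = int_K53 y"
    using eventually_gt_at_top[of 0] by eventually_elim (simp add: int_K53_eq)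
  ultimately show ?thesis by (rule Lim_transform_eventually)
qed

section \<open>The integral of K of order 5/3 over a half-line\<close>

lemma bessel_K_five_thirds:
  assumes x: "x > 0"
  defines "y \<equiv> x\<^sup>2 / 4"
  shows "bessel_K (5 / 3) x =
    - (pi / sqrt 3 * (y powr (- 4 / 3) * reg_0F1 (- 2 / 3) y - y powr (1 / 3) * reg_0F1 (8 / 3) y) * (x / 2))"
proof -
  have y: "y = (x / 2) powr 2" using x by (simp add: y_def power_divide)
  have "sin (5 / 3 * pi) = - sin (pi / 3)"
    using sin_2pi_minus[of "pi / 3"] by (simp add: algebra_simps)
  hence s: "sin (5 / 3 * pi) = - sqrt 3 / 2" by (simp add: sin_60)
  \<comment> \<open>The factor \<open>x / 2\<close> is the derivative of \<open>x^2 / 4\<close>.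
    Splitting it off shows the claim as minus the chain rule for \<open>int_K53\<close>.\<close>
  have p: "y powr a * (x / 2) = (x / 2) powr (2 * a + 1)" for a
    unfolding y powr_powr powr_add using x by simp
  have "bessel_K (5 / 3) x = pi / 2 * ((bessel_I (- (5 / 3)) x - bessel_I (5 / 3) x) / sin (5 / 3 * pi))"
    using fraction_not_in_Ints[of 3 5, where ?'a = real] by (simp add: bessel_K_def Let_def)
  also have "\<dots> = - (pi / sqrt 3 * (bessel_I (- 5 / 3) x - bessel_I (5 / 3) x))"
    unfolding s by (simp add: field_simps)
  also have "bessel_I (- 5 / 3) x = y powr (- 4 / 3) * (x / 2) * reg_0F1 (- 2 / 3) y"
    using p[of "- 4 / 3"] unfolding bessel_I_eq_reg_0F1[OF x] y_def[symmetric] by simp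
  also have "bessel_I (5 / 3) x = y powr (1 / 3) * (x / 2) * reg_0F1 (8 / 3) y"
    using p[of "1 / 3"] unfolding bessel_I_eq_reg_0F1[OF x] y_def[symmetric] by simp
  finally show ?thesis by (simp add: algebra_simps)
qed

text \<open>The fundamental theorem on \<open>{x..b}\<close>, then \<open>b\<close> to infinity;
  nonnegativity of the integrand turns the improper limit into an integral over the
  half-line.\<close>

lemma has_integral_bessel_K_five_thirds:
  assumes x: "x > 0"
  shows "(bessel_K (5 / 3) has_integral (int_K53 (x\<^sup>2 / 4) - pi / sqrt 3)) {x..}"
proof (rule has_integral_to_inf)
  have deriv: "((\<lambda>t. - int_K53 (t\<^sup>2 / 4)) has_real_derivative bessel_K (5 / 3) t) (at t)" if "t > 0" for t
  proof -
    have "((\<lambda>t. t\<^sup>2 / 4) has_real_derivative t / 2) (at t)"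
      by (auto intro!: derivative_eq_intros)
    from DERIV_minus[OF DERIV_chain2[OF has_real_derivative_int_K53 this]] that
    show ?thesis by (simp add: bessel_K_five_thirds)
  qed
  have int: "(bessel_K (5 / 3) has_integral (- int_K53 (b\<^sup>2 / 4) - - int_K53 (x\<^sup>2 / 4))) {x..b}" if "b \<ge> x" for b
    using that x
    by (intro fundamental_theorem_of_calculus)
       (auto simp flip: has_real_derivative_iff_has_vector_derivative
             intro!: has_field_derivative_at_within[OF deriv])
  show "bessel_K (5 / 3) integrable_on {x..b}" for b
    using int[of b] by (cases "b \<ge> x") (auto simp: integrable_on_def)
  have "filterlim (\<lambda>b::real. b\<^sup>2 / 4) at_top at_top"
    by real_asymp
  from tendsto_diff[OF tendsto_const filterlim_compose[OF tendsto_int_K53 this], of "int_K53 (x\<^sup>2 / 4)"]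
  show "((\<lambda>b. integral {x..b} (bessel_K (5 / 3))) \<longlongrightarrow> int_K53 (x\<^sup>2 / 4) - pi / sqrt 3) at_top"
    by (rule Lim_transform_eventually)
       (auto intro!: eventually_at_top_linorderI[of x] simp: integral_unique[OF int])
  show "bessel_K (5 / 3) t \<ge> 0" if "t \<ge> x" for t
  proof -
    have t: "t > 0" using x that by simp
    hence "t\<^sup>2 / 4 > 0" by simp
    from int_K53_deriv_nonpos[OF this] t show ?thesis
      unfolding bessel_K_five_thirds[OF t] neg_0_le_iff_le
      by (intro mult_nonpos_nonneg mult_nonneg_nonpos) auto
  qed
qed

section \<open>The constants of the closed form and the limit at 0\<close>

lemma thirds_not_nonpos_Ints:
  "(- 8 / 3 :: real) \<notin> \<int>\<^sub>\<le>\<^sub>0" "(- 5 / 3 :: real) \<notin> \<int>\<^sub>\<le>\<^sub>0" "(- 2 / 3 :: real) \<notin> \<int>\<^sub>\<le>\<^sub>0"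
  "(2 / 3 :: real) \<notin> \<int>\<^sub>\<le>\<^sub>0" "(5 / 3 :: real) \<notin> \<int>\<^sub>\<le>\<^sub>0" "(8 / 3 :: real) \<notin> \<int>\<^sub>\<le>\<^sub>0"
proof -
  have n: "(- 8 / 3 :: real) \<notin> \<int>" "(- 5 / 3 :: real) \<notin> \<int>" "(- 2 / 3 :: real) \<notin> \<int>"
      "(2 / 3 :: real) \<notin> \<int>" "(5 / 3 :: real) \<notin> \<int>" "(8 / 3 :: real) \<notin> \<int>"
    using fraction_not_in_Ints[of 3 "-8", where ?'a = real] fraction_not_in_Ints[of 3 "-5", where ?'a = real]
      fraction_not_in_Ints[of 3 "-2", where ?'a = real] fraction_not_in_Ints[of 3 2, where ?'a = real]
      fraction_not_in_Ints[of 3 5, where ?'a = real] fraction_not_in_Ints[of 3 8, where ?'a = real]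
    by simp_all
  from n[THEN contra_subsetD[OF nonpos_Ints_subset_Ints]]
  show "(- 8 / 3 :: real) \<notin> \<int>\<^sub>\<le>\<^sub>0" "(- 5 / 3 :: real) \<notin> \<int>\<^sub>\<le>\<^sub>0" "(- 2 / 3 :: real) \<notin> \<int>\<^sub>\<le>\<^sub>0"
  "(2 / 3 :: real) \<notin> \<int>\<^sub>\<le>\<^sub>0" "(5 / 3 :: real) \<notin> \<int>\<^sub>\<le>\<^sub>0" "(8 / 3 :: real) \<notin> \<int>\<^sub>\<le>\<^sub>0" .
qed

lemma hypergeom_1F2_thirds:
  "hypergeom_1F2 (- 1 / 3) (- 2 / 3) (2 / 3) y = - 1 / 3 * Gamma (- 2 / 3) * reg_1F2 (- 1 / 3) (- 2 / 3) y"
  "hypergeom_1F2 (4 / 3) (8 / 3) (7 / 3) y = 4 / 3 * Gamma (8 / 3) * reg_1F2 (4 / 3) (8 / 3) y"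
proof -
  show "hypergeom_1F2 (- 1 / 3) (- 2 / 3) (2 / 3) y = - 1 / 3 * Gamma (- 2 / 3) * reg_1F2 (- 1 / 3) (- 2 / 3) y"
    using hypergeom_1F2_eq_reg_1F2[OF third_not_int thirds_not_nonpos_Ints(3), of y] by simp
  show "hypergeom_1F2 (4 / 3) (8 / 3) (7 / 3) y = 4 / 3 * Gamma (8 / 3) * reg_1F2 (4 / 3) (8 / 3) y"
    using hypergeom_1F2_eq_reg_1F2[OF _ thirds_not_nonpos_Ints(6), of "4 / 3" y] by (simp add: add_eq_0_iff)
qed

text \<open>The cube roots are \<open>x\<close> times the powers of \<open>y\<close> in
  \<open>int_K53\<close>, and each product of Gamma values reduces to \<open>pi / sqrt 3\<close> up
  to sign.\<close>

lemma synchrotron_eq_int_K53: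
  assumes x: "x > 0"
  shows "x * integral {x..} (bessel_K (5 / 3)) =
              - (pi / sqrt 3) * x
              + root 3 (4 * x) * Gamma (2 / 3)
                  * hypergeom_1F2 (- 1 / 3) (- 2 / 3) (2 / 3) (x\<^sup>2 / 4)
              + root 3 (x ^ 11 / 256) * Gamma (- 8 / 3)
                  * hypergeom_1F2 (4 / 3) (8 / 3) (7 / 3) (x\<^sup>2 / 4)" (is "_ = ?rhs")
proof -
  define y where "y = x\<^sup>2 / 4"
  have y: "y = x powr 2 / 2 powr 2" using x by (simp add: y_def)
  have r1: "root 3 (4 * x) = x * y powr (- 1 / 3)"
  proof (rule real_root_pos_unique)
    have "(x * y powr (- 1 / 3)) ^ 3 = x ^ 3 * y powr (- 1)"
      by (simp add: power_mult_distrib flip: powr_numeral powr_powr) (simp add: powr_powr)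
    also have "\<dots> = 4 * x" using x by (simp add: y_def powr_minus_divide power2_eq_square power3_eq_cube)
    finally show "(x * y powr (- 1 / 3)) ^ 3 = 4 * x" .
  qed (use x in auto)
  have r2: "root 3 (x ^ 11 / 256) = x * y powr (4 / 3)"
  proof (rule real_root_pos_unique)
    have "(x * y powr (4 / 3)) ^ 3 = x ^ 3 * y powr 4"
      by (simp add: power_mult_distrib flip: powr_numeral powr_powr) (simp add: powr_powr)
    also have "\<dots> = x ^ 11 / 256" using x by (simp add: y_def power_divide flip: power_mult power_add)
    finally show "(x * y powr (4 / 3)) ^ 3 = x ^ 11 / 256" .
  qed (use x in auto)
  have g: "Gamma (- 5 / 3) = - 8 / 3 * Gamma (- 8 / 3 :: real)" "Gamma (- 2 / 3) = - 5 / 3 * Gamma (- 5 / 3 :: real)"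
    "Gamma (1 / 3) = - 2 / 3 * Gamma (- 2 / 3 :: real)" "Gamma (5 / 3) = 2 / 3 * Gamma (2 / 3 :: real)"
    "Gamma (8 / 3) = 5 / 3 * Gamma (5 / 3 :: real)"
    using thirds_not_nonpos_Ints[THEN Gamma_plus1] by simp_all
  have g1: "Gamma (2 / 3) * (- 1 / 3 * Gamma (- 2 / 3 :: real)) = pi / sqrt 3"
    using Gamma_third unfolding g(3) by (simp add: field_simps)
  \<comment> \<open>The functional equation carries both arguments to 1/3 and 2/3, where reflection
    applies.\<close>
  have "Gamma (- 8 / 3) = - 27 / 80 * Gamma (1 / 3 :: real)"
    using g(1-3) by simp
  moreover have "Gamma (8 / 3) = 10 / 9 * Gamma (2 / 3 :: real)"
    using g(4,5) by simp
  ultimately have "Gamma (- 8 / 3) * (4 / 3 * Gamma (8 / 3 :: real)) = - (Gamma (1 / 3) * Gamma (2 / 3)) / 2"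
    by simp
  hence g2: "Gamma (- 8 / 3) * (4 / 3 * Gamma (8 / 3 :: real)) = - (pi / sqrt 3)"
    unfolding Gamma_third by simp
  have "?rhs = - (pi / sqrt 3) * x + x * y powr (- 1 / 3) * (Gamma (2 / 3) * (- 1 / 3 * Gamma (- 2 / 3))) * reg_1F2 (- 1 / 3) (- 2 / 3) y
      + x * y powr (4 / 3) * (Gamma (- 8 / 3) * (4 / 3 * Gamma (8 / 3))) * reg_1F2 (4 / 3) (8 / 3) y"
    unfolding y_def[symmetric] r1 r2 hypergeom_1F2_thirds by simp
  also have "\<dots> = x * (int_K53 y - pi / sqrt 3)"
    unfolding g1 g2 int_K53_def by (simp add: algebra_simps)
  finally show ?thesis
    using integral_unique[OF has_integral_bessel_K_five_thirds[OF x]] by (simp add: y_def)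
qed

text \<open>The expression is continuous at 0, and every term has a factor that vanishes
  there.\<close>

lemma tendsto_hypergeom_closed_form_0:
  "((\<lambda>x::real. - (pi / sqrt 3) * x
              + root 3 (4 * x) * Gamma (2 / 3)
                  * hypergeom_1F2 (- 1 / 3) (- 2 / 3) (2 / 3) (x\<^sup>2 / 4)
              + root 3 (x ^ 11 / 256) * Gamma (- 8 / 3)
                  * hypergeom_1F2 (4 / 3) (8 / 3) (7 / 3) (x\<^sup>2 / 4)) \<longlongrightarrow> 0) (at_right 0)"
proof -
  have c: "isCont (hypergeom_1F2 (- 1 / 3) (- 2 / 3) (2 / 3)) y" "isCont (hypergeom_1F2 (4 / 3) (8 / 3) (7 / 3)) y" for y
  proof -
    have "hypergeom_1F2 (- 1 / 3) (- 2 / 3) (2 / 3) = (\<lambda>y. - 1 / 3 * Gamma (- 2 / 3) * reg_1F2 (- 1 / 3) (- 2 / 3) y)"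
      "hypergeom_1F2 (4 / 3) (8 / 3) (7 / 3) = (\<lambda>y. 4 / 3 * Gamma (8 / 3) * reg_1F2 (4 / 3) (8 / 3) y)"
      by (rule ext, rule hypergeom_1F2_thirds)+
    thus "isCont (hypergeom_1F2 (- 1 / 3) (- 2 / 3) (2 / 3)) y" "isCont (hypergeom_1F2 (4 / 3) (8 / 3) (7 / 3)) y"
      by (simp_all add: isCont_reg_1F2)
  qed
  have "isCont (\<lambda>x::real. - (pi / sqrt 3) * x
              + root 3 (4 * x) * Gamma (2 / 3)
                  * hypergeom_1F2 (- 1 / 3) (- 2 / 3) (2 / 3) (x\<^sup>2 / 4)
              + root 3 (x ^ 11 / 256) * Gamma (- 8 / 3)
                  * hypergeom_1F2 (4 / 3) (8 / 3) (7 / 3) (x\<^sup>2 / 4)) 0"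
    by (intro continuous_intros isCont_o2[OF _ c(1)] isCont_o2[OF _ c(2)] isCont_o2[OF _ isCont_real_root]) auto
  thus ?thesis using tendsto_within_subset[where S = UNIV and T = "{0<..}"] by (fastforce simp: isCont_def)
qed

theorem mainTheorem1:
  shows "(\<forall>x::real. 0 \<le> x \<longrightarrow>
            synchrotron x =
              - (pi / sqrt 3) * x
              + root 3 (4 * x) * Gamma (2 / 3)
                  * hypergeom_1F2 (- 1 / 3) (- 2 / 3) (2 / 3) (x\<^sup>2 / 4)
              + root 3 (x ^ 11 / 256) * Gamma (- 8 / 3)
                  * hypergeom_1F2 (4 / 3) (8 / 3) (7 / 3) (x\<^sup>2 / 4))
         \<and> (synchrotron \<longlongrightarrow> synchrotron 0) (at_right 0)"
proof -
  let ?F = "\<lambda>x. x * integral {x..} (bessel_K (5 / 3))"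
  have "\<forall>\<^sub>F x in at_right 0. ?F x = - (pi / sqrt 3) * x
              + root 3 (4 * x) * Gamma (2 / 3)
                  * hypergeom_1F2 (- 1 / 3) (- 2 / 3) (2 / 3) (x\<^sup>2 / 4)
              + root 3 (x ^ 11 / 256) * Gamma (- 8 / 3)
                  * hypergeom_1F2 (4 / 3) (8 / 3) (7 / 3) (x\<^sup>2 / 4)"
    by (intro eventually_mono[OF eventually_at_right_less] synchrotron_eq_int_K53)
  hence F0: "(?F \<longlongrightarrow> 0) (at_right 0)"
    using tendsto_hypergeom_closed_form_0 by (subst tendsto_cong)
  \<comment> \<open>\<open>Lim\<close> is known to be the limit only once convergence is
    established, which \<open>F0\<close> provides.\<close>
  hence s0: "synchrotron 0 = 0"
    by (simp add: synchrotron_def tendsto_Lim)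
  have s: "synchrotron x = ?F x" if "x > 0" for x
    using that by (simp add: synchrotron_def)
  have "\<forall>\<^sub>F x in at_right 0. ?F x = synchrotron x"
    using s by (intro eventually_mono[OF eventually_at_right_less]) simp
  with F0 have "(synchrotron \<longlongrightarrow> synchrotron 0) (at_right 0)"
    unfolding s0 by (rule Lim_transform_eventually)
  moreover have "synchrotron x =
              - (pi / sqrt 3) * x
              + root 3 (4 * x) * Gamma (2 / 3)
                  * hypergeom_1F2 (- 1 / 3) (- 2 / 3) (2 / 3) (x\<^sup>2 / 4)
              + root 3 (x ^ 11 / 256) * Gamma (- 8 / 3)
                  * hypergeom_1F2 (4 / 3) (8 / 3) (7 / 3) (x\<^sup>2 / 4)" if "x \<ge> 0" for x
  proof (cases "x = 0")
    case False
    with that have "x > 0" by simp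
    thus ?thesis using synchrotron_eq_int_K53 s by simp
  qed (simp add: s0)
  ultimately show ?thesis by blast
qed

end
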